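(* Consider the hexagon equations for dilogarithms, i.e. the following system for six unknown functions $f_0,f_1,\dots,f_5$, where for each $j\in\{0,2,4\}$ both $f_j$ and $f_{j-1}$ are holomorphic in $\mathbf{D}_{t_j^{-1}(0)}$ (that is, $f_0,f_5$ are holomorphic in $\mathbf{D}_0$; $f_2,f_1$ in $\mathbf{D}_1$; $f_4,f_3$ in $\mathbf{D}_\infty$), all indices being taken modulo $6$: for $j=0,2,4$, $$f_j(z)+\log z_j\,\log z_{j+1}+f_{j+1}(z)=\zeta(2)\qquad \text{for } z\in \mathbf{D}_{t_j^{-1}(0)}\cap\mathbf{D}_{t_j^{-1}(1)},$$ $$f_{j-1}(z)=-f_j(z)-\tfrac12\log^2 z_{j+1}\qquad \text{for } z\in\mathbf{D}_{t_j^{-1}(0)}.$$ This system has a unique solution $(f_0,\dots,f_5)$ under the normalization condition $f_0(0)=0$, and the solution is expressed as $$f_i(z)=\mathrm{Li}_2(z_i)\qquad (i=0,1,\dots,5).$$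
   Context: Let $\mathbf{P}^1=\mathbf{C}\cup\{\infty\}$ be the Riemann sphere, with open subsets $\mathbf{D}_0=\mathbf{C}\setminus[1,+\infty)$, $\mathbf{D}_1=\mathbf{C}\setminus(-\infty,0]$, $\mathbf{D}_\infty=\mathbf{P}^1\setminus[0,1]$, which are open neighborhoods of $0,1,\infty$ respectively. (A function holomorphic in $\mathbf{D}_\infty$ is in particular holomorphic at $\infty$.) Define automorphisms $t_i$ of $\mathbf{P}^1$ and write $z_i=t_i(z)$: $z_0=z$, $z_1=1-z$, $z_2=\frac{z-1}{z}$, $z_3=\frac1z$, $z_4=\frac1{1-z}$, $z_5=\frac{z}{z-1}$; the index $i$ is taken modulo $6$. One has $t_0^{-1}(0)=0,\ t_0^{-1}(1)=1$; $t_2^{-1}(0)=1,\ t_2^{-1}(1)=\infty$; $t_4^{-1}(0)=\infty,\ t_4^{-1}(1)=0$. Each $t_i$ gives an analytic isomorphism $\mathbf{D}_\alpha\to\mathbf{D}_{t_i(\alpha)}$ for $\alpha\in\{0,1,\infty\}$. $\log$ denotes the principal branch on $\mathbf{C}\setminus(-\infty,0]$ (with $\log 1=0$), and $\log^2 w=(\log w)^2$. $\zeta(2)=\sum_{n\ge1}n^{-2}$. The dilogarithm $\mathrm{Li}_2$ is the holomorphic function on $\mathbf{D}_0$ given by $\mathrm{Li}_2(z)=-\int_0^z\frac{\log(1-t)}{t}\,dt$ (integral along a path in $\mathbf{D}_0$), so that $\mathrm{Li}_2(z)=\sum_{n\ge1}z^n/n^2$ for $|z|<1$. *)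

theory Defs
  imports "HOL-Complex_Analysis.Complex_Analysis" "HOL-Library.Numeral_Type"
begin

section \<open>The Riemann sphere\<close>

datatype riemann_sphere = Fin (fin: complex) | Infty

text \<open>The coordinate chart of the sphere around infinity is \<open>z \<mapsto> 1 / z\<close>; this is its inverse.\<close>

definition inf_chart :: "complex \<Rightarrow> riemann_sphere" where
  "inf_chart w = (if w = 0 then Infty else Fin (1 / w))"

text \<open>Holomorphy is tested in the two standard charts. As usual this is meant for open \<open>U\<close>,
  i.e. for \<open>U\<close> whose preimages under both chart maps are open; see \<open>open_D\<close> below for
  the sets in question.\<close>

definition sphere_holomorphic_on :: "(riemann_sphere \<Rightarrow> complex) \<Rightarrow> riemann_sphere set \<Rightarrow> bool" where
  "sphere_holomorphic_on f U \<longleftrightarrow>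
     (\<lambda>w. f (Fin w)) holomorphic_on (Fin -` U) \<and>
     (\<lambda>w. f (inf_chart w)) holomorphic_on (inf_chart -` U)"

definition moebius :: "complex \<Rightarrow> complex \<Rightarrow> complex \<Rightarrow> complex \<Rightarrow> riemann_sphere \<Rightarrow> riemann_sphere" where
  "moebius a b c d z = (case z of
       Fin w \<Rightarrow> if c * w + d = 0 then Infty else Fin ((a * w + b) / (c * w + d))
     | Infty \<Rightarrow> if c = 0 then Infty else Fin (a / c))"

text \<open>The indices live in the library type \<open>6\<close> of integers modulo 6, so index arithmetic
  such as \<open>j - 1\<close> is automatically modulo 6.\<close>

definition t :: "6 \<Rightarrow> riemann_sphere \<Rightarrow> riemann_sphere" where
  "t i = (if i = 0 then moebius 1 0 0 1
     else if i = 1 then moebius (-1) 1 0 1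
     else if i = 2 then moebius 1 (-1) 1 0
     else if i = 3 then moebius 0 1 1 0
     else if i = 4 then moebius 0 1 (-1) 1
     else moebius 1 0 1 (-1))"

text \<open>Only \<open>D (Fin 0)\<close>, \<open>D (Fin 1)\<close> and \<open>D Infty\<close> are meaningful.\<close>

definition D :: "riemann_sphere \<Rightarrow> riemann_sphere set" where
  "D \<alpha> = (if \<alpha> = Fin 0 then Fin ` (UNIV - complex_of_real ` {1..})
     else if \<alpha> = Fin 1 then Fin ` (UNIV - complex_of_real ` {..0})
     else if \<alpha> = Infty then UNIV - Fin ` complex_of_real ` {0..1}
     else undefined)"

section \<open>The dilogarithm\<close>

text \<open>The slit plane \<open>D (Fin 0)\<close> is star-shaped about 0, so the straight segment from 0 to \<open>z\<close>
  serves as the path of integration. The junk value of the integrand at its removable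
  singularity 0 does not affect the integral.\<close>

definition Li2 :: "complex \<Rightarrow> complex" where
  "Li2 z = - contour_integral (linepath 0 z) (\<lambda>s. Ln (1 - s) / s)"

definition zeta2 :: complex where
  "zeta2 = (\<Sum>n. 1 / of_nat (Suc n) ^ 2)"

section \<open>The hexagon equations\<close>

text \<open>For \<open>j \<in> {0, 2, 4}\<close>, both \<open>f\<^sub>j\<close> and \<open>f\<^sub>j\<^sub>-\<^sub>1\<close> are functions on \<open>D\<close> of the zero of \<open>t\<^sub>j\<close>.\<close>

definition hex_dom :: "6 \<Rightarrow> riemann_sphere set" where
  "hex_dom i = (if i \<in> {0, 2, 4} then D (inv (t i) (Fin 0)) else D (inv (t (i + 1)) (Fin 0)))"

text \<open>The unknown \<open>f\<^sub>i\<close> is a function on \<open>hex_dom i\<close>; as functions are total, this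
  is encoded by extensionality (the value \<open>undefined\<close> outside the domain), so that equality of
  solutions is equality on the domains. The points to which \<open>fin\<close> is applied are always finite
  in the ranges of \<open>z\<close> considered: there \<open>t\<^sub>j z\<close> lies in \<open>D (Fin 0)\<close> and
  \<open>t\<^sub>j\<^sub>+\<^sub>1 z = 1 - t\<^sub>j z\<close> in \<open>D (Fin 1)\<close>.\<close>

definition hexagon_system :: "(6 \<Rightarrow> riemann_sphere \<Rightarrow> complex) \<Rightarrow> bool" where
  "hexagon_system f \<longleftrightarrow>
     (\<forall>i. f i \<in> extensional (hex_dom i) \<and> sphere_holomorphic_on (f i) (hex_dom i)) \<and>
     (\<forall>j\<in>{0, 2, 4}.
        (\<forall>z \<in> D (inv (t j) (Fin 0)) \<inter> D (inv (t j) (Fin 1)).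
           f j z + Ln (fin (t j z)) * Ln (fin (t (j + 1) z)) + f (j + 1) z = zeta2) \<and>
        (\<forall>z \<in> D (inv (t j) (Fin 0)).
           f (j - 1) z = - f j z - 1 / 2 * Ln (fin (t (j + 1) z)) ^ 2))"

section \<open>Consistency checks\<close>

lemma moebius_inverse:
  assumes "a * d - b * c \<noteq> 0"
  shows "moebius d (-b) (-c) a (moebius a b c d z) = z"
proof (cases z)
  case Infty
  then show ?thesis using assms by (auto simp: moebius_def field_simps)
next
  case (Fin w)
  show ?thesis
  proof (cases "c * w + d = 0")
    case True
    then have d: "d = - (c * w)" by (simp add: add_eq_0_iff)
    then have "c \<noteq> 0" using assms by auto
    then show ?thesis using True Fin d by (simp add: moebius_def)
  next
    case False
    have 1: "- c * ((a * w + b) / (c * w + d)) + a = (a * d - b * c) / (c * w + d)"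
      using False by (simp add: field_simps)
    have 2: "d * ((a * w + b) / (c * w + d)) + - b = w * (a * d - b * c) / (c * w + d)"
      using False by (simp add: field_simps)
    have "moebius a b c d z = Fin ((a * w + b) / (c * w + d))"
      using False Fin by (simp add: moebius_def)
    then have "moebius d (-b) (-c) a (moebius a b c d z)
        = moebius d (-b) (-c) a (Fin ((a * w + b) / (c * w + d)))" by (rule arg_cong)
    also have "\<dots> = Fin (w * (a * d - b * c) / (c * w + d) / ((a * d - b * c) / (c * w + d)))"
      unfolding moebius_def riemann_sphere.case 1 2 using False assms by simp
    also have "\<dots> = z" using False Fin assms by simp
    finally show ?thesis .
  qed
qed

lemma inj_t: "inj (t i)"
proof -
  have "inj (moebius a b c d)" if "a * d - b * c \<noteq> 0" for a b c d
    by (rule inj_on_inverseI[where g = "moebius d (-b) (-c) a"]) (rule moebius_inverse[OF that])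
  then show ?thesis by (simp add: t_def)
qed

lemma t_inv_values:
  "inv (t 0) (Fin 0) = Fin 0" "inv (t 0) (Fin 1) = Fin 1"
  "inv (t 2) (Fin 0) = Fin 1" "inv (t 2) (Fin 1) = Infty"
  "inv (t 4) (Fin 0) = Infty" "inv (t 4) (Fin 1) = Fin 0"
  by (rule inv_f_eq[OF inj_t], simp add: t_def moebius_def)+

lemma index_arith: "(5::6) + 1 = 0" "(3::6) + 1 = 4" "(1::6) + 1 = 2"
    "(0::6) - 1 = 5" "(2::6) - 1 = 1" "(4::6) - 1 = 3"
  by simp_all

lemma hex_dom_simps:
  "hex_dom 0 = D (Fin 0)" "hex_dom 5 = D (Fin 0)"
  "hex_dom 2 = D (Fin 1)" "hex_dom 1 = D (Fin 1)"
  "hex_dom 4 = D Infty" "hex_dom 3 = D Infty"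
  by (simp_all add: hex_dom_def t_inv_values index_arith del: one_add_one add_numeral_special numeral_plus_one)

lemma inf_chart_vimage_D:
  "inf_chart -` D (Fin 0) = UNIV - complex_of_real ` {0..1}"
  "inf_chart -` D (Fin 1) = UNIV - complex_of_real ` {..0}"
  "inf_chart -` D Infty = UNIV - complex_of_real ` {1..}"
proof -
  have inv_eq: "1 / w = complex_of_real r \<longleftrightarrow> w = complex_of_real (1 / r)"
    if "w \<noteq> 0" for w r
    using that by (cases "r = 0") (auto simp: field_simps)
  have *: "1 / w \<in> complex_of_real ` A \<longleftrightarrow> w \<in> complex_of_real ` ((\<lambda>r. 1 / r) ` A)"
    if "w \<noteq> 0" for w A
    using inv_eq[OF that] by (auto simp: image_iff)
  have img: "(\<lambda>r::real. 1 / r) ` A = {s. 1 / s \<in> A}" for A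
  proof (intro equalityI subsetI)
    fix s assume "s \<in> {s. 1 / s \<in> A}"
    then show "s \<in> (\<lambda>r. 1 / r) ` A" by (intro image_eqI[where x = "1 / s"]) auto
  qed auto
  have A: "(\<lambda>r::real. 1 / r) ` {1..} = {0<..1}"
    unfolding img by (auto simp: le_divide_eq_1)
  have B: "(\<lambda>r::real. 1 / r) ` {..0} = {..0}"
    unfolding img by (auto simp: divide_le_0_iff)
  have C: "(\<lambda>r::real. 1 / r) ` {0..1} = insert 0 {1..}"
    unfolding img by (auto simp: divide_le_eq_1)
  have mem: "inf_chart w \<in> D (Fin 0) \<longleftrightarrow> w \<noteq> 0 \<and> 1 / w \<notin> complex_of_real ` {1..}"
    "inf_chart w \<in> D (Fin 1) \<longleftrightarrow> w \<noteq> 0 \<and> 1 / w \<notin> complex_of_real ` {..0}"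
    "inf_chart w \<in> D Infty \<longleftrightarrow> w = 0 \<or> 1 / w \<notin> complex_of_real ` {0..1}" for w
    by (auto simp: inf_chart_def D_def)
  have "w \<noteq> 0 \<and> 1 / w \<notin> complex_of_real ` {1..} \<longleftrightarrow> w \<notin> complex_of_real ` {0..1}"
    "w \<noteq> 0 \<and> 1 / w \<notin> complex_of_real ` {..0} \<longleftrightarrow> w \<notin> complex_of_real ` {..0}"
    "w = 0 \<or> 1 / w \<notin> complex_of_real ` {0..1} \<longleftrightarrow> w \<notin> complex_of_real ` {1..}" for w
    subgoal using *[of w "{1..}"] unfolding A by (cases "w = 0") force+
    subgoal using *[of w "{..0}"] unfolding B by (cases "w = 0") force+
    subgoal using *[of w "{0..1}"] unfolding C by (cases "w = 0") force+
    done
  then show "inf_chart -` D (Fin 0) = UNIV - complex_of_real ` {0..1}"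
    "inf_chart -` D (Fin 1) = UNIV - complex_of_real ` {..0}"
    "inf_chart -` D Infty = UNIV - complex_of_real ` {1..}"
    by (auto simp only: set_eq_iff vimage_eq mem Diff_iff UNIV_I)
qed

lemma open_D:
  assumes "\<alpha> \<in> {Fin 0, Fin 1, Infty}"
  shows "open (Fin -` D \<alpha>)" "open (inf_chart -` D \<alpha>)"
proof -
  have cl: "closed (complex_of_real ` S)" if "closed S" for S
    by (rule closed_injective_linear_image[OF that])
      (auto simp: inj_on_def intro: bounded_linear.linear bounded_linear_of_real)
  have op: "open (UNIV - complex_of_real ` {1..})" "open (UNIV - complex_of_real ` {..0})"
     "open (UNIV - complex_of_real ` {0..1})"
    by (auto intro!: open_Diff cl)
  have eq: "Fin -` D (Fin 0) = UNIV - complex_of_real ` {1..}"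
     "Fin -` D (Fin 1) = UNIV - complex_of_real ` {..0}"
     "Fin -` D Infty = UNIV - complex_of_real ` {0..1}"
    by (auto simp: D_def)
  show "open (Fin -` D \<alpha>)" using assms op eq by auto
  show "open (inf_chart -` D \<alpha>)" using assms op inf_chart_vimage_D by auto
qed

end

(* Existence is Euler's reflection formula and Landen's identity for Li2, transported by t_j: both
   sides have equal derivatives on a star-shaped domain, and the constants are read off at 0, for
   Euler's formula through the limit x -> 0+ and the continuity of the sum of z^n / n^2 on the
   closed unit disc.
   Uniqueness: the equations for the differences d_i of two solutions express d_1, d_3, d_5 through
   d_2, d_4, d_0 and make d_0, d_2, d_4 agree on overlaps. Since the domains D cover the sphere, these
   glue to a function holomorphic on the whole sphere, which is constant by Liouville's theorem and
   vanishes at 0. *)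
theory Submission
  imports Defs "HOL-Real_Asymp.Real_Asymp"
begin

section \<open>Analysis of the dilogarithm\<close>

lemma starlike_if_closed_segment:
  fixes a :: complex
  assumes "a \<in> S" "\<And>x. x \<in> S \<Longrightarrow> closed_segment a x \<subseteq> S"
  shows "starlike S"
  using assms unfolding starlike_def by blast

lemma Fin_in_D0_iff: "Fin w \<in> D (Fin 0) \<longleftrightarrow> 1 - w \<notin> \<real>\<^sub>\<le>\<^sub>0"
proof -
  have "w \<in> complex_of_real ` {1..} \<longleftrightarrow> 1 - w \<in> \<real>\<^sub>\<le>\<^sub>0"
    by (auto simp: complex_nonpos_Reals_iff image_iff complex_eq_iff)
  then show ?thesis by (auto simp: D_def)
qed

lemma Infty_notin_D0: "Infty \<notin> D (Fin 0)"
  by (auto simp: D_def)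

lemma D0_cases:
  assumes "p \<in> D (Fin 0)"
  obtains w where "p = Fin w" "1 - w \<notin> \<real>\<^sub>\<le>\<^sub>0"
  using assms Fin_in_D0_iff Infty_notin_D0 by (cases p) auto

text \<open>Since \<open>a\<close> is a positive real, the imaginary part at parameter
  \<open>u\<close> is \<open>u * Im z\<close>. For \<open>u\<close> > 0 it can vanish only if
  \<open>z\<close> is real, hence positive, and then the real part is a convex combination of
  positive numbers.\<close>

lemma closed_segment_slit_plane:
  assumes "a \<notin> \<real>\<^sub>\<le>\<^sub>0" "Im a = 0" "z \<notin> \<real>\<^sub>\<le>\<^sub>0" "x \<in> closed_segment a z"
  shows "x \<notin> \<real>\<^sub>\<le>\<^sub>0"
proof -
  obtain u where u: "0 \<le> u" "u \<le> 1" and x: "x = (1 - u) *\<^sub>R a + u *\<^sub>R z"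
    using assms(4) by (auto simp: in_segment)
  have a: "Re a > 0" using assms(1,2) by (auto simp: complex_nonpos_Reals_iff)
  have "Im z \<noteq> 0 \<or> Re z > 0" using assms(3) by (auto simp: complex_nonpos_Reals_iff)
  moreover have "(1 - u) * Re a + u * Re z > 0" if "Re z > 0"
  proof (cases "u = 0")
    case False
    then have "u * Re z > 0" "(1 - u) * Re a \<ge> 0" using u a that by auto
    then show ?thesis by linarith
  qed (use a in auto)
  ultimately show ?thesis
    using assms(2) u a by (cases "u = 0") (auto simp: complex_nonpos_Reals_iff x)
qed

lemma closed_segment_one_minus:
  fixes a z x :: complex
  assumes "x \<in> closed_segment a z"
  shows "1 - x \<in> closed_segment (1 - a) (1 - z)"
  using assms by (auto simp: in_segment algebra_simps)

text \<open>The reflection w \<mapsto> 1 - w carries the slit plane, with centre 1, to this set,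
  with centre 0.\<close>

lemma starlike_D0: "starlike {w::complex. 1 - w \<notin> \<real>\<^sub>\<le>\<^sub>0}"
proof (rule starlike_if_closed_segment[where a = 0])
  fix z :: complex assume "z \<in> {w. 1 - w \<notin> \<real>\<^sub>\<le>\<^sub>0}"
  then show "closed_segment 0 z \<subseteq> {w. 1 - w \<notin> \<real>\<^sub>\<le>\<^sub>0}"
    using closed_segment_slit_plane[of 1 "1 - z"] closed_segment_one_minus[of _ 0 z] by auto
qed simp

text \<open>The centre 1/2 is fixed by w \<mapsto> 1 - w, so the same segment argument serves both
  slits.\<close>

lemma starlike_D0_inter_D1: "starlike {w::complex. w \<notin> \<real>\<^sub>\<le>\<^sub>0 \<and> 1 - w \<notin> \<real>\<^sub>\<le>\<^sub>0}"
proof (rule starlike_if_closed_segment[where a = "1/2"])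
  show "1/2 \<in> {w::complex. w \<notin> \<real>\<^sub>\<le>\<^sub>0 \<and> 1 - w \<notin> \<real>\<^sub>\<le>\<^sub>0}"
    by (auto simp: complex_nonpos_Reals_iff)
  fix z :: complex assume z: "z \<in> {w. w \<notin> \<real>\<^sub>\<le>\<^sub>0 \<and> 1 - w \<notin> \<real>\<^sub>\<le>\<^sub>0}"
  have h: "(1/2::complex) \<notin> \<real>\<^sub>\<le>\<^sub>0" "Im (1/2::complex) = 0" by (auto simp: complex_nonpos_Reals_iff)
  show "closed_segment (1/2) z \<subseteq> {w. w \<notin> \<real>\<^sub>\<le>\<^sub>0 \<and> 1 - w \<notin> \<real>\<^sub>\<le>\<^sub>0}"
    using z closed_segment_slit_plane[OF h] closed_segment_one_minus[of _ "1/2" z] by auto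
qed

lemma open_slit_preimage:
  assumes "continuous_on UNIV f"
  shows "open {w. f w \<notin> (\<real>\<^sub>\<le>\<^sub>0 :: complex set)}"
proof -
  have "open (f -` (- \<real>\<^sub>\<le>\<^sub>0))"
    using assms by (intro open_vimage) (auto simp: closed_nonpos_Reals_complex)
  then show ?thesis by (simp add: vimage_def)
qed

lemma open_D0: "open {w::complex. 1 - w \<notin> \<real>\<^sub>\<le>\<^sub>0}"
  by (rule open_slit_preimage) (intro continuous_intros)

lemma open_D0_inter_D1: "open {w::complex. w \<notin> \<real>\<^sub>\<le>\<^sub>0 \<and> 1 - w \<notin> \<real>\<^sub>\<le>\<^sub>0}"
  by (intro open_Collect_conj open_slit_preimage continuous_intros)

section \<open>The derivative of the dilogarithm\<close>

definition Li2_deriv :: "complex \<Rightarrow> complex" where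
  "Li2_deriv s = (if s = 0 then 1 else - Ln (1 - s) / s)"

text \<open>The function -Ln(1 - s) vanishes at 0 with derivative 1 there, so
  \<open>Li2_deriv\<close> is its difference quotient at 0 with the removable singularity filled in;
  the pole lemma applies.\<close>

lemma Li2_deriv_holomorphic: "Li2_deriv holomorphic_on {w. 1 - w \<notin> \<real>\<^sub>\<le>\<^sub>0}"
proof -
  have "((\<lambda>s. - Ln (1 - s)) has_field_derivative 1) (at 0)"
    by (auto intro!: derivative_eq_intros)
  then have "deriv (\<lambda>s. - Ln (1 - s)) 0 = 1" by (rule DERIV_imp_deriv)
  moreover have "(\<lambda>z. if z = 0 then deriv (\<lambda>s. - Ln (1 - s)) 0
      else (- Ln (1 - z) - - Ln (1 - 0)) / (z - 0)) holomorphic_on {w. 1 - w \<notin> \<real>\<^sub>\<le>\<^sub>0}"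
    by (intro pole_lemma_open open_D0 holomorphic_intros) auto
  moreover have "Li2_deriv = (\<lambda>z. if z = 0 then 1 else (- Ln (1 - z) - - Ln (1 - 0)) / (z - 0))"
    by (auto simp: Li2_deriv_def)
  ultimately show ?thesis by metis
qed

text \<open>On a star-shaped domain \<open>Li2_deriv\<close> has a primitive \<open>F\<close>, and
  the integral along the segment from 0 evaluates to an increment of \<open>F\<close>.\<close>

lemma Li2_has_field_derivative:
  assumes "1 - z \<notin> \<real>\<^sub>\<le>\<^sub>0"
  shows "(Li2 has_field_derivative Li2_deriv z) (at z)"
proof -
  let ?S = "{w::complex. 1 - w \<notin> \<real>\<^sub>\<le>\<^sub>0}"
  obtain F where F: "\<And>x. x \<in> ?S \<Longrightarrow> (F has_field_derivative Li2_deriv x) (at x)"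
    using holomorphic_starlike_primitive[OF holomorphic_on_imp_continuous_on[OF Li2_deriv_holomorphic]
        starlike_D0 open_D0 finite.emptyI]
      holomorphic_on_imp_differentiable_at[OF Li2_deriv_holomorphic open_D0] by auto
  have Li2_eq: "Li2 w = F w - F 0" if w: "w \<in> ?S" for w
  proof (cases "w = 0")
    case False
    \<comment> \<open>The integrands differ only at 0, where division by zero gives 0 on the left
      and \<open>- Li2_deriv 0\<close> is -1. Ignoring one point this way requires a simple path,
      hence the separate case \<open>w = 0\<close>.\<close>
    have "contour_integral (linepath 0 w) (\<lambda>s. Ln (1 - s) / s)
        = contour_integral (linepath 0 w) (\<lambda>s. - Li2_deriv s)"
      by (rule contour_integral_spike_finite_simple_path[of "{0}"])
         (use False in \<open>auto simp: Li2_deriv_def\<close>)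
    moreover have "path_image (linepath 0 w) \<subseteq> ?S"
      using w closed_segment_slit_plane[of 1 "1 - w"] closed_segment_one_minus[of _ 0 w] by auto
    then have "(Li2_deriv has_contour_integral (F w - F 0)) (linepath 0 w)"
      using contour_integral_primitive[of ?S F Li2_deriv "linepath 0 w"] F
      by (auto intro: has_field_derivative_at_within)
    then have "((\<lambda>s. - Li2_deriv s) has_contour_integral - (F w - F 0)) (linepath 0 w)"
      by (rule has_contour_integral_neg)
    ultimately show ?thesis
      by (simp add: Li2_def contour_integral_unique)
  qed (simp add: Li2_def)
  have "((\<lambda>w. F w - F 0) has_field_derivative Li2_deriv z) (at z)"
    using F[of z] assms by (auto intro!: derivative_eq_intros)
  then show ?thesis
    by (rule has_field_derivative_transform_within_open[OF _ open_D0]) (use assms Li2_eq in auto)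
qed

lemmas Li2_derivative_intro [derivative_intros] = DERIV_chain2[OF Li2_has_field_derivative]

lemma Li2_holomorphic: "Li2 holomorphic_on {w. 1 - w \<notin> \<real>\<^sub>\<le>\<^sub>0}"
  using Li2_has_field_derivative
  by (auto simp: holomorphic_on_open[OF open_D0])

lemma Li2_0 [simp]: "Li2 0 = 0"
  by (simp add: Li2_def)

section \<open>Landen's identity\<close>

lemma constant_on_starlike:
  fixes f :: "complex \<Rightarrow> complex"
  assumes "starlike S" "open S" "\<And>z. z \<in> S \<Longrightarrow> (f has_field_derivative 0) (at z)"
    and "a \<in> S" "b \<in> S"
  shows "f a = f b"
proof -
  have "continuous_on S f"
    using assms(3) by (intro DERIV_continuous_on[of S f "\<lambda>_. 0"]) (auto intro: has_field_derivative_at_within)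
  then obtain c where "\<And>z. z \<in> S \<Longrightarrow> f z = c"
    using DERIV_zero_connected_constant[of S "{}" f] assms starlike_imp_connected[OF assms(1)] by auto
  then show ?thesis using assms by simp
qed

text \<open>Used to see that w \<mapsto> w / (w - 1) preserves the slit domain and replaces 1 - w by
  its inverse.\<close>

lemma slit_reciprocal: "1 - w / (w - 1) = inverse (1 - w)" if "w \<noteq> 1" for w :: complex
  using that by (simp add: divide_simps)

lemma Landen_identity:
  assumes "1 - z \<notin> \<real>\<^sub>\<le>\<^sub>0"
  shows "Li2 (z / (z - 1)) = - Li2 z - 1 / 2 * Ln (1 - z) ^ 2"
proof -
  define H where "H = (\<lambda>w. Li2 (w / (w - 1)) + Li2 w + 1 / 2 * Ln (1 - w) ^ 2)"
  have "(H has_field_derivative 0) (at w)" if w: "1 - w \<notin> \<real>\<^sub>\<le>\<^sub>0" for w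
  proof -
    have w1: "w \<noteq> 1" using w by auto
    have slit: "1 - w / (w - 1) \<notin> \<real>\<^sub>\<le>\<^sub>0"
      using slit_reciprocal[OF w1] w by simp
    \<comment> \<open>Off the slit the principal branch turns inversion into a change of
      sign.\<close>
    have Ln: "Ln (1 - w / (w - 1)) = - Ln (1 - w)"
      using slit_reciprocal[OF w1] Ln_inverse[OF w] by simp
    have "(H has_field_derivative Li2_deriv (w / (w - 1)) * (- 1 / (w - 1) ^ 2)
        + Li2_deriv w - Ln (1 - w) / (1 - w)) (at w)"
      unfolding H_def using w w1 slit
      by (auto intro!: derivative_eq_intros simp: power2_eq_square divide_simps)
    also have "Li2_deriv (w / (w - 1)) * (- 1 / (w - 1) ^ 2) + Li2_deriv w - Ln (1 - w) / (1 - w) = 0"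
    proof (cases "w = 0")
      case False
      have "Li2_deriv (w / (w - 1)) = Ln (1 - w) * (w - 1) / w"
        using False w1 by (simp add: Li2_deriv_def Ln)
      moreover have "Li2_deriv w = - Ln (1 - w) / w" using False by (simp add: Li2_deriv_def)
      \<comment> \<open>With the logarithm abstracted to \<open>L\<close>, the cancellation is an
        identity of rational functions.\<close>
      moreover have "L * (w - 1) / w * (- 1 / (w - 1) ^ 2) + - L / w - L / (1 - w) = 0" for L
      proof -
        have "L / (1 - w) = - L / (w - 1)" using w1 by (metis minus_diff_eq minus_divide_divide minus_minus)
        moreover have "L * (w - 1) / w * (- 1 / (w - 1) ^ 2) + - L / w - - L / (w - 1) = 0"
          using False w1 by (simp add: divide_simps power2_eq_square) (simp add: algebra_simps)
        ultimately show ?thesis by simp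
      qed
      ultimately show ?thesis by simp
    \<comment> \<open>At \<open>w = 0\<close> the three terms are -1, 1 and 0.\<close>
    qed (simp add: Li2_deriv_def)
    finally show ?thesis .
  qed
  then have "H z = H 0"
    by (intro constant_on_starlike[OF starlike_D0 open_D0]) (use assms in auto)
  then show ?thesis by (simp add: H_def algebra_simps add_eq_0_iff)
qed

section \<open>The power series and its limit at 1\<close>

lemma summable_inverse_squares: "summable (\<lambda>n. 1 / real n ^ 2)"
  using inverse_power_summable[of 2, where ?'a = real] by (simp add: inverse_eq_divide)

text \<open>The terms are dominated by 1/n^2 up to the boundary, so convergence is uniform there
  too; this later gives access to the boundary point 1. The sum may start at n = 0 because 1 / 0 =
  0.\<close>

lemma dilog_series_continuous: "continuous_on (cball 0 1) (\<lambda>z::complex. \<Sum>n. 1 / of_nat n ^ 2 * z ^ n)"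
proof -
  have "uniform_limit (cball 0 1) (\<lambda>n z. \<Sum>i<n. 1 / of_nat i ^ 2 * z ^ i :: complex)
      (\<lambda>z. \<Sum>n. 1 / of_nat n ^ 2 * z ^ n) sequentially"
  proof (rule Weierstrass_m_test[OF _ summable_inverse_squares])
    fix n and z :: complex assume "z \<in> cball 0 1"
    then have "norm z ^ n \<le> 1" by (simp add: power_le_one)
    then show "norm (1 / of_nat n ^ 2 * z ^ n) \<le> 1 / real n ^ 2"
      by (simp add: norm_mult norm_divide norm_power divide_right_mono)
  qed
  then show ?thesis
    by (rule uniform_limit_theorem[rotated])
       (auto intro!: always_eventually continuous_on_sum continuous_on_mult_left continuous_on_power
         simp del: times_divide_eq_left mult_1_left)
qed

text \<open>Both sides vanish at 0, and termwise differentiation gives the logarithm series divided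
  by w, which is \<open>Li2_deriv\<close>.\<close>

lemma Li2_series:
  assumes "norm z < 1"
  shows "Li2 z = (\<Sum>n. 1 / of_nat n ^ 2 * z ^ n)"
proof -
  define P where "P = (\<lambda>z::complex. \<Sum>n. 1 / of_nat n ^ 2 * z ^ n)"
  let ?c = "\<lambda>n. 1 / of_nat n ^ 2 :: complex"
  have slit: "1 - w \<notin> \<real>\<^sub>\<le>\<^sub>0" if "norm w < 1" for w :: complex
    using that complex_Re_le_cmod[of w] by (auto simp: complex_nonpos_Reals_iff)
  have der: "(P has_field_derivative Li2_deriv w) (at w)" if w: "norm w < 1" for w
  proof -
    have "summable ?c"
      by (rule summable_norm_cancel) (use summable_inverse_squares in \<open>simp add: norm_divide norm_power\<close>)
    then have "(P has_field_derivative (\<Sum>n. diffs ?c n * w ^ n)) (at w)"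
      unfolding P_def by (intro termdiffs_strong[where K = 1]) (use w in auto)
    moreover have "(\<Sum>n. diffs ?c n * w ^ n) = Li2_deriv w"
    proof (cases "w = 0")
      case False
      have "(\<lambda>n. - ((- (- w)) ^ n) / of_nat n) sums Ln (1 + - w)"
        by (rule Ln_series') (use w in simp)
      then have "(\<lambda>n. - (w ^ n) / of_nat n) sums Ln (1 - w)" by simp
      \<comment> \<open>The shift loses nothing: the term at n = 0 is -1 / 0 = 0.\<close>
      then have "(\<lambda>n. - (w ^ Suc n) / of_nat (Suc n)) sums Ln (1 - w)"
        by (subst sums_Suc_iff) simp
      then have "(\<lambda>n. - (w ^ Suc n) / of_nat (Suc n) * (- 1 / w)) sums (Ln (1 - w) * (- 1 / w))"
        by (rule sums_mult2)
      moreover have "- (w ^ Suc n) / of_nat (Suc n) * (- 1 / w) = diffs ?c n * w ^ n" for n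
        using False by (simp add: diffs_def power2_eq_square del: of_nat_Suc)
      ultimately have "(\<lambda>n. diffs ?c n * w ^ n) sums (Ln (1 - w) * (- 1 / w))" by simp
      then show ?thesis using False by (simp add: Li2_deriv_def sums_unique[symmetric])
    next
      case True
      have "(\<Sum>n. diffs ?c n * 0 ^ n) = diffs ?c 0" by (rule powser_zero)
      then show ?thesis using True by (simp add: Li2_deriv_def diffs_def)
    qed
    ultimately show ?thesis by simp
  qed
  have "starlike (ball (0::complex) 1)" by (rule convex_imp_starlike) auto
  moreover have "((\<lambda>w. Li2 w - P w) has_field_derivative 0) (at w)" if "w \<in> ball 0 1" for w
    using DERIV_diff[OF Li2_has_field_derivative der, of w] slit that by simp
  ultimately have "Li2 z - P z = Li2 0 - P 0"
    using constant_on_starlike[of "ball 0 1" "\<lambda>w. Li2 w - P w" z 0] assms by auto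
  moreover have "P 0 = 0" using powser_zero[of ?c] by (simp add: P_def)
  ultimately show ?thesis by (simp add: P_def)
qed

text \<open>The point 1 lies on the cut of \<open>Li2\<close>, so its value there is replaced by a
  one-sided limit, computed with the series, which is continuous on the closed disc.\<close>

lemma Li2_tendsto_zeta2: "((\<lambda>x. Li2 (1 - of_real x)) \<longlongrightarrow> zeta2) (at_right 0)"
proof -
  let ?P = "\<lambda>z::complex. \<Sum>n. 1 / of_nat n ^ 2 * z ^ n"
  have "?P 1 = zeta2"
  proof -
    have "summable (\<lambda>n. 1 / of_nat n ^ 2 :: complex)"
      by (rule summable_norm_cancel) (use summable_inverse_squares in \<open>simp add: norm_divide norm_power\<close>)
    \<comment> \<open>\<open>zeta2\<close> starts at index 1; the head term split off is 1 / 0 =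
      0.\<close>
    from suminf_split_head[OF this] show ?thesis by (simp add: zeta2_def)
  qed
  have ev: "\<forall>\<^sub>F x::real in at_right 0. 0 < x \<and> x < 1"
    by (intro eventually_conj eventually_at_right_less eventually_at_right_real[THEN eventually_mono]) auto
  have norm: "norm (1 - complex_of_real x) = 1 - x" if "0 < x" "x < 1" for x
    using that by (metis abs_of_pos diff_gt_0_iff_gt norm_of_real of_real_1 of_real_diff)
  have "((\<lambda>x. ?P (1 - of_real x)) \<longlongrightarrow> ?P 1) (at_right 0)"
  proof (rule continuous_on_tendsto_compose[OF dilog_series_continuous])
    show "((\<lambda>x. 1 - complex_of_real x) \<longlongrightarrow> 1) (at_right 0)"
      by (auto intro!: tendsto_eq_intros)
    show "\<forall>\<^sub>F x in at_right 0. 1 - complex_of_real x \<in> cball 0 1"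
      using ev by eventually_elim (auto simp: norm)
  qed auto
  moreover have "\<forall>\<^sub>F x in at_right 0. ?P (1 - of_real x) = Li2 (1 - of_real x)"
    using ev by eventually_elim (subst Li2_series, auto simp: norm)
  ultimately show ?thesis
    unfolding \<open>?P 1 = zeta2\<close> by (rule Lim_transform_eventually)
qed

text \<open>The two terms of the product rule for Ln w Ln(1 - w) are the negatives of the
  derivatives of the two dilogarithms.\<close>

lemma Euler_reflection:
  assumes "z \<notin> \<real>\<^sub>\<le>\<^sub>0" "1 - z \<notin> \<real>\<^sub>\<le>\<^sub>0"
  shows "Li2 z + Ln z * Ln (1 - z) + Li2 (1 - z) = zeta2"
proof -
  define H where "H = (\<lambda>w. Li2 w + Ln w * Ln (1 - w) + Li2 (1 - w))"
  have "(H has_field_derivative 0) (at w)" if w: "w \<notin> \<real>\<^sub>\<le>\<^sub>0" "1 - w \<notin> \<real>\<^sub>\<le>\<^sub>0" for w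
  proof -
    have nz: "w \<noteq> 0" "w \<noteq> 1" using w by auto
    show ?thesis
      unfolding H_def using w nz
      by (auto intro!: derivative_eq_intros simp: Li2_deriv_def divide_simps)
  qed
  then have const: "H w = H z" if "w \<notin> \<real>\<^sub>\<le>\<^sub>0" "1 - w \<notin> \<real>\<^sub>\<le>\<^sub>0" for w
    by (intro constant_on_starlike[OF starlike_D0_inter_D1 open_D0_inter_D1]) (use assms that in auto)
  have ev: "\<forall>\<^sub>F x::real in at_right 0. 0 < x \<and> x < 1"
    by (intro eventually_conj eventually_at_right_less eventually_at_right_real[THEN eventually_mono]) auto
  \<comment> \<open>0 is only a boundary point of the domain, so the constant is a limit along the
    positive reals. It is written as three summands to match those of \<open>H\<close>.\<close>
  have "((\<lambda>x. H (of_real x)) \<longlongrightarrow> 0 + of_real 0 + zeta2) (at_right 0)"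
    unfolding H_def
  proof (intro tendsto_add Li2_tendsto_zeta2)
    have "isCont Li2 0" using Li2_has_field_derivative[of 0] by (auto intro: DERIV_isCont)
    then show "((\<lambda>x. Li2 (complex_of_real x)) \<longlongrightarrow> 0) (at_right 0)"
      using isCont_tendsto_compose[of 0 Li2 complex_of_real "at_right 0"]
        tendsto_of_real[OF tendsto_ident_at, of 0 "{0<..}"] by simp
    \<comment> \<open>ln(1 - x) behaves like -x, which outweighs the divergence of ln x.\<close>
    have "((\<lambda>x::real. ln x * ln (1 - x)) \<longlongrightarrow> 0) (at_right 0)" by real_asymp
    then have "((\<lambda>x. complex_of_real (ln x * ln (1 - x))) \<longlongrightarrow> of_real 0) (at_right 0)"
      by (rule tendsto_of_real)
    moreover have "\<forall>\<^sub>F x in at_right 0.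
        complex_of_real (ln x * ln (1 - x)) = Ln (of_real x) * Ln (1 - of_real x)"
      using ev
    proof eventually_elim
      case (elim x)
      then show ?case using Ln_of_real[of x] Ln_of_real[of "1 - x"] by simp
    qed
    ultimately show "((\<lambda>x. Ln (complex_of_real x) * Ln (1 - complex_of_real x)) \<longlongrightarrow> of_real 0) (at_right 0)"
      by (rule Lim_transform_eventually)
  qed
  moreover have "\<forall>\<^sub>F x in at_right 0. H (of_real x) = H z"
    using ev by eventually_elim (auto intro!: const simp: complex_nonpos_Reals_iff)
  then have "((\<lambda>x. H (of_real x)) \<longlongrightarrow> H z) (at_right 0)" by (rule tendsto_eventually)
  ultimately have "H z = zeta2" using tendsto_unique[OF trivial_limit_at_right_real] by fastforce
  then show ?thesis by (simp add: H_def)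
qed

section \<open>Functions on the sphere\<close>

text \<open>Precomposing with w \<mapsto> 1 / w swaps the columns of the matrix; thus holomorphy in
  the chart at infinity reduces to the finite chart.\<close>

lemma moebius_inf_chart: "moebius a b c d (inf_chart w) = moebius b a d c (Fin w)"
  by (auto simp: moebius_def inf_chart_def divide_simps add_ac)

lemma Li2_moebius_holomorphic_chart:
  assumes "\<And>w. w \<in> V \<Longrightarrow> moebius a b c d (Fin w) \<in> D (Fin 0)"
  shows "(\<lambda>w. Li2 (fin (moebius a b c d (Fin w)))) holomorphic_on V"
proof -
  \<comment> \<open>The target domain omits \<open>Infty\<close>, which excludes a vanishing
    denominator.\<close>
  have *: "c * w + d \<noteq> 0 \<and> 1 - (a * w + b) / (c * w + d) \<notin> \<real>\<^sub>\<le>\<^sub>0" if "w \<in> V" for w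
    using assms[OF that] Infty_notin_D0 by (auto simp: moebius_def Fin_in_D0_iff split: if_splits)
  have "(Li2 \<circ> (\<lambda>w. (a * w + b) / (c * w + d))) holomorphic_on V"
    by (rule holomorphic_on_compose_gen[OF _ Li2_holomorphic]) (use * in \<open>auto intro!: holomorphic_intros\<close>)
  then show ?thesis
    by (rule holomorphic_transform) (use * in \<open>auto simp: moebius_def\<close>)
qed

lemma Li2_moebius_sphere_holomorphic:
  assumes "\<And>z. z \<in> V \<Longrightarrow> moebius a b c d z \<in> D (Fin 0)"
  shows "sphere_holomorphic_on (\<lambda>z. Li2 (fin (moebius a b c d z))) V"
  unfolding sphere_holomorphic_on_def moebius_inf_chart
proof (intro conjI Li2_moebius_holomorphic_chart)
  show "moebius b a d c (Fin w) \<in> D (Fin 0)" if "w \<in> inf_chart -` V" for w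
    using assms[of "inf_chart w"] that by (simp add: moebius_inf_chart)
qed (use assms in auto)

lemma sphere_holomorphic_on_cong:
  assumes "\<And>z. z \<in> V \<Longrightarrow> f z = g z"
  shows "sphere_holomorphic_on f V \<longleftrightarrow> sphere_holomorphic_on g V"
  unfolding sphere_holomorphic_on_def using assms
  by (intro conj_cong holomorphic_cong) auto

lemma sphere_holomorphic_on_diff:
  assumes "sphere_holomorphic_on f V" "sphere_holomorphic_on g V"
  shows "sphere_holomorphic_on (\<lambda>z. f z - g z) V"
  using assms unfolding sphere_holomorphic_on_def by (auto intro!: holomorphic_intros)

section \<open>The six maps and their domains\<close>

lemma index_cases:
  obtains "i = 0" | "i = 1" | "i = 2" | "i = 3" | "i = 4" | "i = (5::6)"
proof -
  obtain k :: int where i: "i = of_int k" and "0 \<le> k" "k < 6"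
    by (cases i rule: bit0_cases) auto
  then have "k = 0 \<or> k = 1 \<or> k = 2 \<or> k = 3 \<or> k = 4 \<or> k = 5" by presburger
  then show thesis using i that by auto
qed

lemma t_simps:
  "t 0 = moebius 1 0 0 1" "t 1 = moebius (-1) 1 0 1" "t 2 = moebius 1 (-1) 1 0"
  "t 3 = moebius 0 1 1 0" "t 4 = moebius 0 1 (-1) 1" "t 5 = moebius 1 0 1 (-1)"
  by (simp_all add: t_def)

text \<open>Describes the preimage of the cut under \<open>t 3\<close>, and, applied to 1 - w, under
  \<open>t 4\<close>. Solving 1 - 1 / w = r for w gives 1 / (1 - r), which lies in the unit interval
  for r \<le> 0.\<close>

lemma unit_interval_reciprocal:
  assumes "w \<noteq> 0"
  shows "1 - 1 / w \<in> \<real>\<^sub>\<le>\<^sub>0 \<longleftrightarrow> w \<in> complex_of_real ` {0..1}"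
proof
  assume "1 - 1 / w \<in> \<real>\<^sub>\<le>\<^sub>0"
  then obtain r where r: "r \<le> 0" "1 - 1 / w = of_real r" by (auto simp: nonpos_Reals_def)
  have "w = 1 / (1 - of_real r)" unfolding r(2)[symmetric] by simp
  then have "w = of_real (1 / (1 - r))" by simp
  moreover have "1 / (1 - r) \<in> {0..1}" using r(1) by (simp add: divide_simps)
  ultimately show "w \<in> complex_of_real ` {0..1}" by blast
next
  assume "w \<in> complex_of_real ` {0..1}"
  then obtain x where x: "0 < x" "x \<le> 1" "w = of_real x" using assms by force
  then have "1 - 1 / w = of_real (1 - 1 / x)" by simp
  moreover have "1 - 1 / x \<le> 0" using x by (simp add: divide_simps)
  ultimately show "1 - 1 / w \<in> \<real>\<^sub>\<le>\<^sub>0" by (metis nonpos_Reals_of_real_iff)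
qed

lemma Fin_in_D1_iff: "Fin w \<in> D (Fin 1) \<longleftrightarrow> w \<notin> \<real>\<^sub>\<le>\<^sub>0"
  by (auto simp: D_def nonpos_Reals_def)

lemma Infty_notin_D1: "Infty \<notin> D (Fin 1)"
  by (auto simp: D_def)

lemma Fin_in_DInfty_iff: "Fin w \<in> D Infty \<longleftrightarrow> w \<notin> complex_of_real ` {0..1}"
  by (auto simp: D_def)

lemma Infty_in_DInfty: "Infty \<in> D Infty"
  by (auto simp: D_def)

text \<open>Reduces all domain conditions to the single slit domain on which \<open>Li2\<close> is
  holomorphic.\<close>

lemma hex_dom_iff: "z \<in> hex_dom i \<longleftrightarrow> t i z \<in> D (Fin 0)"
proof (cases z)
  case Infty
  show ?thesis
    by (cases i rule: index_cases)
       (simp_all add: Infty hex_dom_simps t_simps moebius_def Fin_in_D0_iff Infty_notin_D0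
         Infty_notin_D1 Infty_in_DInfty)
next
  case (Fin w)
  note defs = Fin hex_dom_simps t_simps moebius_def Fin_in_D0_iff Infty_notin_D0
    Fin_in_D1_iff Fin_in_DInfty_iff
  show ?thesis
  proof (cases i rule: index_cases)
    \<comment> \<open>Cases are numbered from 1, so this one is \<open>i = 2\<close>.\<close>
    case 3
    have "1 - (w - 1) / w = inverse w" if "w \<noteq> 0" using that by (simp add: field_simps)
    then show ?thesis using 3 by (auto simp: defs)
  next
    case 4
    show ?thesis using 4 unit_interval_reciprocal[of w] by (cases "w = 0") (auto simp: defs)
  next
    case 5
    have "w \<in> complex_of_real ` {0..1} \<longleftrightarrow> 1 - w \<in> complex_of_real ` {0..1}"
      by (auto simp: image_iff complex_eq_iff)
    then show ?thesis using 5 unit_interval_reciprocal[of "1 - w"] by (cases "w = 1") (auto simp: defs)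
  next
    case 6
    show ?thesis using 6 slit_reciprocal[of w] by (cases "w = 1") (auto simp: defs)
  qed (auto simp: defs)
qed

lemma minus_one_mod_6: "(-1 :: 6) = 5"
  by simp

text \<open>These are the substitutions in Euler's and Landen's formulas, so the equations for each
  \<open>j\<close> become those for \<open>j = 0\<close> in the coordinate
  \<open>t j z\<close>.\<close>

lemma t_neighbours:
  assumes "j \<in> {0, 2, 4}"
  shows "t (j + 1) z = moebius (-1) 1 0 1 (t j z)" "t (j - 1) z = moebius 1 0 1 (-1) (t j z)"
proof -
  consider "j = 0" | "j = 2" | "j = 4" using assms by auto
  then have "t (j + 1) z = moebius (-1) 1 0 1 (t j z) \<and> t (j - 1) z = moebius 1 0 1 (-1) (t j z)"
  proof cases
    case 1
    then show ?thesis by (cases z) (simp_all add: minus_one_mod_6 t_simps moebius_def)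
  next
    case 2
    then show ?thesis by (cases z) (simp_all add: t_simps moebius_def field_simps)
  next
    case 3
    then show ?thesis by (cases z) (simp_all add: t_simps moebius_def field_simps)
  qed
  then show "t (j + 1) z = moebius (-1) 1 0 1 (t j z)" "t (j - 1) z = moebius 1 0 1 (-1) (t j z)"
    by auto
qed

lemma hex_dom_neighbours:
  assumes "j \<in> {0, 2, 4}"
  shows "D (inv (t j) (Fin 0)) = hex_dom j" "D (inv (t j) (Fin 1)) = hex_dom (j + 1)"
    "D (inv (t j) (Fin 0)) = hex_dom (j - 1)"
  using assms by (auto simp: t_inv_values hex_dom_simps minus_one_mod_6)

section \<open>Existence and uniqueness\<close>

text \<open>The restriction provides the extensionality that \<open>hexagon_system\<close>
  demands.\<close>

definition hexagon_solution :: "6 \<Rightarrow> riemann_sphere \<Rightarrow> complex" where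
  "hexagon_solution i = restrict (\<lambda>z. Li2 (fin (t i z))) (hex_dom i)"

lemma hexagon_solution_holomorphic: "sphere_holomorphic_on (hexagon_solution i) (hex_dom i)"
proof -
  obtain a b c d where t: "t i = moebius a b c d"
    by (cases i rule: index_cases) (auto simp: t_simps)
  have "sphere_holomorphic_on (\<lambda>z. Li2 (fin (moebius a b c d z))) (hex_dom i)"
    by (rule Li2_moebius_sphere_holomorphic) (simp add: hex_dom_iff t)
  then show ?thesis
    by (subst sphere_holomorphic_on_cong[where g = "\<lambda>z. Li2 (fin (t i z))"])
       (auto simp: hexagon_solution_def t)
qed

lemma hexagon_solution_correct: "hexagon_system hexagon_solution"
  unfolding hexagon_system_def
proof (intro conjI allI ballI)
  show "hexagon_solution i \<in> extensional (hex_dom i)" for i by (simp add: hexagon_solution_def)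
  show "sphere_holomorphic_on (hexagon_solution i) (hex_dom i)" for i
    by (rule hexagon_solution_holomorphic)
next
  fix j z assume j: "j \<in> {0, 2, 4::6}" and z: "z \<in> D (inv (t j) (Fin 0)) \<inter> D (inv (t j) (Fin 1))"
  have dom: "z \<in> hex_dom j" "z \<in> hex_dom (j + 1)"
    using z hex_dom_neighbours[OF j] by blast+
  obtain w where w: "t j z = Fin w" "1 - w \<notin> \<real>\<^sub>\<le>\<^sub>0"
    using dom(1) D0_cases unfolding hex_dom_iff by blast
  have t1: "t (j + 1) z = Fin (1 - w)" using t_neighbours(1)[OF j] w by (simp add: moebius_def)
  \<comment> \<open>Membership in the second domain is the slit condition for 1 - (1 - w).\<close>
  have "w \<notin> \<real>\<^sub>\<le>\<^sub>0" using dom(2) t1 by (simp add: hex_dom_iff Fin_in_D0_iff)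
  then show "hexagon_solution j z + Ln (fin (t j z)) * Ln (fin (t (j + 1) z))
      + hexagon_solution (j + 1) z = zeta2"
    using dom Euler_reflection[of w] w t1 by (simp add: hexagon_solution_def)
next
  fix j z assume j: "j \<in> {0, 2, 4::6}" and z: "z \<in> D (inv (t j) (Fin 0))"
  have dom: "z \<in> hex_dom j" "z \<in> hex_dom (j - 1)"
    using z hex_dom_neighbours[OF j] by blast+
  obtain w where w: "t j z = Fin w" "1 - w \<notin> \<real>\<^sub>\<le>\<^sub>0"
    using dom(1) D0_cases unfolding hex_dom_iff by blast
  have t1: "t (j + 1) z = Fin (1 - w)" using t_neighbours(1)[OF j] w by (simp add: moebius_def)
  have "w \<noteq> 1" using w by auto
  then have t2: "t (j - 1) z = Fin (w / (w - 1))"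
    using t_neighbours(2)[OF j] w by (simp add: moebius_def)
  show "hexagon_solution (j - 1) z
      = - hexagon_solution j z - 1 / 2 * Ln (fin (t (j + 1) z)) ^ 2"
    using dom Landen_identity[OF w(2)] w t1 t2 by (simp add: hexagon_solution_def)
qed

section \<open>Uniqueness\<close>

lemma hexagon_system_unique:
  assumes f: "hexagon_system f" and g: "hexagon_system g" and eq0: "f 0 (Fin 0) = g 0 (Fin 0)"
  shows "f = g"
proof -
  define d where "d = (\<lambda>i z. f i z - g i z)"
  have hol: "sphere_holomorphic_on (d i) (hex_dom i)" for i
    using f g unfolding d_def hexagon_system_def by (intro sphere_holomorphic_on_diff) auto
  \<comment> \<open>The system is affine in the unknowns: \<open>zeta2\<close> and the logarithms
    cancel in differences.\<close>
  have reflect: "d j z + d (j + 1) z = 0"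
    if "j \<in> {0, 2, 4}" "z \<in> hex_dom j" "z \<in> hex_dom (j + 1)" for j z
  proof -
    have "h j z + Ln (fin (t j z)) * Ln (fin (t (j + 1) z)) + h (j + 1) z = zeta2"
      if "hexagon_system h" for h
      using that \<open>j \<in> _\<close> \<open>z \<in> hex_dom j\<close> \<open>z \<in> hex_dom (j + 1)\<close> hex_dom_neighbours(1,2)[OF \<open>j \<in> _\<close>]
      unfolding hexagon_system_def by blast
    moreover have "A - A' + (B - B') = 0" if "A + L + B = Z" "A' + L + B' = Z"
      for A A' B B' L Z :: complex
      using that by (auto simp: algebra_simps)
    ultimately show ?thesis using f g unfolding d_def by blast
  qed
  have invert: "d (j - 1) z = - d j z" if "j \<in> {0, 2, 4}" "z \<in> hex_dom j" for j z
  proof -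
    have "h (j - 1) z = - h j z - 1 / 2 * Ln (fin (t (j + 1) z)) ^ 2"
      if "hexagon_system h" for h
      using that \<open>j \<in> _\<close> \<open>z \<in> hex_dom j\<close> hex_dom_neighbours(1)[OF \<open>j \<in> _\<close>]
      unfolding hexagon_system_def by blast
    from this[OF f] this[OF g] show ?thesis unfolding d_def by simp
  qed
  have d5: "d 5 z = - d 0 z" if "z \<in> D (Fin 0)" for z
    using invert[of 0 z] that by (simp add: hex_dom_simps minus_one_mod_6)
  have d1: "d 1 z = - d 2 z" if "z \<in> D (Fin 1)" for z
    using invert[of 2 z] that by (simp add: hex_dom_simps)
  have d3: "d 3 z = - d 4 z" if "z \<in> D Infty" for z
    using invert[of 4 z] that by (simp add: hex_dom_simps)
  have d02: "d 0 z = d 2 z" if "z \<in> D (Fin 0)" "z \<in> D (Fin 1)" for z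
    using reflect[of 0 z] d1[of z] that by (simp add: hex_dom_simps)
  have d24: "d 2 z = d 4 z" if "z \<in> D (Fin 1)" "z \<in> D Infty" for z
    using reflect[of 2 z] d3[of z] that by (simp add: hex_dom_simps)
  have d40: "d 4 z = d 0 z" if "z \<in> D Infty" "z \<in> D (Fin 0)" for z
    using reflect[of 4 z] d5[of z] that by (simp add: hex_dom_simps)
  have cover: "Fin w \<in> D (Fin 0) \<or> Fin w \<in> D (Fin 1)" for w
    by (auto simp: Fin_in_D0_iff Fin_in_D1_iff complex_nonpos_Reals_iff)

  \<comment> \<open>Two of the three domains already cover the finite plane, so two pieces define an
    entire function; the third controls it at infinity.\<close>
  define G where "G = (\<lambda>w. if w \<in> Fin -` D (Fin 0) then d 0 (Fin w) else d 2 (Fin w))"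
  have G1: "G w = d 0 (Fin w)" if "Fin w \<in> D (Fin 0)" for w
    using that by (simp add: G_def)
  have G2: "G w = d 2 (Fin w)" if "Fin w \<in> D (Fin 1)" for w
    using that d02 by (simp add: G_def)
  \<comment> \<open>By \<open>cover\<close>, the point lies in one of the first two domains as well,
    where \<open>d 4\<close> agrees with the piece defining \<open>G\<close>.\<close>
  have G4: "G w = d 4 (Fin w)" if "Fin w \<in> D Infty" for w
    using that d24 d40 cover[of w] by (auto simp: G_def)
  have "G holomorphic_on (Fin -` D (Fin 0) \<union> Fin -` D (Fin 1))"
    unfolding G_def
    using hol[of 0] hol[of 2] open_D(1)[of "Fin 0"] open_D(1)[of "Fin 1"] d02
    by (intro holomorphic_on_If_Un) (auto simp: sphere_holomorphic_on_def hex_dom_simps)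
  moreover have "Fin -` D (Fin 0) \<union> Fin -` D (Fin 1) = UNIV" using cover by auto
  ultimately have entire: "G holomorphic_on UNIV" by simp
  \<comment> \<open>Near 0, G(1 / w) is \<open>d 4\<close> read in the chart at infinity, which is
    continuous at 0.\<close>
  have "(G \<longlongrightarrow> d 4 Infty) at_infinity"
  proof (rule lim_zero_infinity)
    let ?V = "inf_chart -` D Infty"
    have V: "open ?V" "0 \<in> ?V" using open_D(2)[of Infty] by (auto simp: inf_chart_def Infty_in_DInfty)
    have "(\<lambda>w. d 4 (inf_chart w)) holomorphic_on ?V"
      using hol[of 4] by (simp add: sphere_holomorphic_on_def hex_dom_simps)
    then have "continuous_on ?V (\<lambda>w. d 4 (inf_chart w))" by (rule holomorphic_on_imp_continuous_on)
    then have "((\<lambda>w. d 4 (inf_chart w)) \<longlongrightarrow> d 4 (inf_chart 0)) (at 0)"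
      using V continuous_on_eq_continuous_at isContD by blast
    moreover have "\<forall>\<^sub>F w in at 0. d 4 (inf_chart w) = G (1 / w)"
      using eventually_at_in_open[OF V]
      by eventually_elim (auto simp: inf_chart_def G4)
    ultimately show "((\<lambda>w. G (1 / w)) \<longlongrightarrow> d 4 Infty) (at 0)"
      using Lim_transform_eventually by (fastforce simp: inf_chart_def)
  qed
  note const = Liouville_weak[OF entire this]
  have "Fin 0 \<in> D (Fin 0)" by (simp add: Fin_in_D0_iff)
  then have "G 0 = 0" by (simp add: G_def d_def eq0)
  \<comment> \<open>The constant value of \<open>G\<close> is its limit \<open>d 4 Infty\<close>;
    the normalization at 0 makes it zero.\<close>
  then have inf0: "d 4 Infty = 0" and G0: "G w = 0" for w using const by metis+
  have z0: "d 0 z = 0" if "z \<in> D (Fin 0)" for z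
    using that G0 G1 by (cases z) (auto simp: Infty_notin_D0)
  have z2: "d 2 z = 0" if "z \<in> D (Fin 1)" for z
    using that G0 G2 by (cases z) (auto simp: Infty_notin_D1)
  have z4: "d 4 z = 0" if "z \<in> D Infty" for z
    using that G0 G4 inf0 by (cases z) auto
  have "d i z = 0" if "z \<in> hex_dom i" for i z
    using that z0 z2 z4 d1 d3 d5 by (cases i rule: index_cases) (auto simp: hex_dom_simps)
  then have "f i z = g i z" if "z \<in> hex_dom i" for i z
    using that by (simp add: d_def)
  \<comment> \<open>Off the domains both solutions take the value \<open>undefined\<close>, so
    agreement on the domains gives equality.\<close>
  moreover have "f i \<in> extensional (hex_dom i)" "g i \<in> extensional (hex_dom i)" for i
    using f g by (simp_all add: hexagon_system_def)
  ultimately have "f i = g i" for i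
    by (intro extensionalityI[of "f i" "hex_dom i" "g i"]) auto
  then show ?thesis by (rule ext)
qed

theorem theorem4p1:
  "(\<exists>!f. hexagon_system f \<and> f 0 (Fin 0) = 0) \<and>
   (\<forall>f. hexagon_system f \<and> f 0 (Fin 0) = 0 \<longrightarrow>
      (\<forall>i. \<forall>z \<in> hex_dom i. f i z = Li2 (fin (t i z))))"
proof -
  have "Fin 0 \<in> hex_dom 0" "t 0 (Fin 0) = Fin 0"
    by (simp_all add: hex_dom_simps Fin_in_D0_iff t_simps moebius_def)
  then have normalized: "hexagon_solution 0 (Fin 0) = 0"
    by (simp add: hexagon_solution_def)
  have unique: "f = hexagon_solution" if "hexagon_system f \<and> f 0 (Fin 0) = 0" for f
    using that normalized by (intro hexagon_system_unique hexagon_solution_correct) auto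
  moreover have "hexagon_solution i z = Li2 (fin (t i z))" if "z \<in> hex_dom i" for i z
    using that by (simp add: hexagon_solution_def)
  ultimately show ?thesis
    using hexagon_solution_correct normalized by blast
qed

end
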